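(* Let $R_0>0$ and $C_V>0$ be constants, and for $h\in(0,1]$ let $V=V(\cdot;h)\in L^\infty(\mathbb{R}^d;\mathbb{C})$ be a bounded, possibly complex-valued potential, possibly depending on $h$, with $\|V\|_\infty\leq C_V$ and with support contained in the ball $B(0,R_0)$, where $C_V$ and $R_0$ are independent of $h$. Let $P_V=-h^2\Delta+V$. Let $I\subset\mathbb{R}$ be a compact interval and let $R>R_0$. Then there exist a real-valued smooth function $\phi\in C^\infty(\mathbb{R}^d)$ and constants $C>0$ and $h_0\in(0,1]$ such that for all $u\in C_c^\infty(B(0,R))$, all $\lambda\in I$ and all $0<h\leq h_0$, $$\int e^{2\phi/h^{4/3}}\left(|u|^2+|h\nabla u|^2\right)dx\leq\frac{C}{h^{2/3}}\int e^{2\phi/h^{4/3}}\,|(P_V-\lambda^2)u|^2\,dx.$$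
   Context: $B(0,r)\subset\mathbb{R}^d$ is the ball of radius $r$ centered at $0$. The function $\phi$ and the constants $C,h_0$ do not depend on $h$, $u$ or $\lambda$. *)

theory Defs
  imports "HOL-Analysis.Analysis" "HOL-Probability.Essential_Supremum"
begin

text \<open>
  Functions on \<open>\<real>\<^sup>d\<close> are functions on an arbitrary type of class \<^class>\<open>euclidean_space\<close>.
  Partial derivatives are taken in the directions of the standard orthonormal basis
  \<open>Basis\<close>; \<open>frechet_derivative\<close> is only meaningful at points of differentiability, so
  the operators below are meant for smooth functions.
\<close>

definition partial :: "'a::euclidean_space \<Rightarrow> ('a \<Rightarrow> 'b::real_normed_vector) \<Rightarrow> 'a \<Rightarrow> 'b" where
  "partial b f x = frechet_derivative f (at x) b"

primrec Ck :: "nat \<Rightarrow> ('a::euclidean_space \<Rightarrow> 'b::real_normed_vector) \<Rightarrow> bool" where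
  "Ck 0 f \<longleftrightarrow> continuous_on UNIV f"
| "Ck (Suc k) f \<longleftrightarrow> (\<forall>x. f differentiable (at x)) \<and> (\<forall>b\<in>Basis. Ck k (partial b f))"

definition smooth :: "('a::euclidean_space \<Rightarrow> 'b::real_normed_vector) \<Rightarrow> bool" where
  "smooth f \<longleftrightarrow> (\<forall>k. Ck k f)"

definition Cc_infinity :: "'a::euclidean_space set \<Rightarrow> ('a \<Rightarrow> complex) set" where
  "Cc_infinity U = {u. smooth u \<and> compact (closure {x. u x \<noteq> 0}) \<and> closure {x. u x \<noteq> 0} \<subseteq> U}"

text \<open>The Euclidean norm of the gradient, a vector in \<open>\<complex>\<^sup>d\<close>.\<close>

definition grad_norm :: "('a::euclidean_space \<Rightarrow> complex) \<Rightarrow> 'a \<Rightarrow> real" where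
  "grad_norm u x = sqrt (\<Sum>b\<in>Basis. (norm (partial b u x))\<^sup>2)"

definition laplacian :: "('a::euclidean_space \<Rightarrow> complex) \<Rightarrow> 'a \<Rightarrow> complex" where
  "laplacian u x = (\<Sum>b\<in>Basis. partial b (partial b u) x)"

definition schroedinger ::
    "real \<Rightarrow> ('a::euclidean_space \<Rightarrow> complex) \<Rightarrow> ('a \<Rightarrow> complex) \<Rightarrow> 'a \<Rightarrow> complex" where
  "schroedinger h W u x = - (of_real (h\<^sup>2) * laplacian u x) + W x * u x"

text \<open>
  The \<open>L\<^sup>\<infinity>\<close> norm, with value \<open>\<infinity>\<close> on functions outside \<open>L\<^sup>\<infinity>\<close> (\<open>esssup\<close> is
  \<open>\<infinity>\<close> if the modulus is not measurable), and the support of a function given only up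
  to null sets: the complement of the largest open set on which it vanishes almost everywhere.
\<close>

definition Linf_norm :: "('a::euclidean_space \<Rightarrow> complex) \<Rightarrow> ereal" where
  "Linf_norm f = esssup lebesgue (\<lambda>x. ereal (norm (f x)))"

definition ess_support :: "('a::euclidean_space \<Rightarrow> complex) \<Rightarrow> 'a set" where
  "ess_support f = - \<Union>{U. open U \<and> (AE x in lebesgue. x \<in> U \<longrightarrow> f x = 0)}"

end

theory Submission
  imports Defs
begin

text \<open>
  Since \<open>V - \<lambda>\<^sup>2\<close> is uniformly bounded, it is treated entirely as a perturbation of \<open>-h\<^sup>2\<Delta>\<close>.
  For the convex weight \<open>s\<^sup>2/2\<close>, where \<open>s(x) = x\<^sub>1 + R + 1 \<ge> 1\<close> on \<open>B(0,R)\<close>, put \<open>w = exp(\<tau>s\<^sup>2)\<close>.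
  Conjugating the Laplacian with the square root of \<open>w\<close> gives \<open>S + A\<close> with \<open>S = \<Delta> + \<tau>\<^sup>2s\<^sup>2\<close> symmetric and
  \<open>A = -2\<tau>s\<partial>\<^sub>1 - \<tau>\<close> antisymmetric, and the commutator term
  \<open>2 Re \<langle>Sv, Av\<rangle> = 4\<tau>\<parallel>\<partial>\<^sub>1v\<parallel>\<^sup>2 + 4\<tau>\<^sup>3\<parallel>sv\<parallel>\<^sup>2\<close> yields
  \<open>4\<tau>\<^sup>3 \<integral>w|u|\<^sup>2 \<le> \<integral>w|\<Delta>u|\<^sup>2\<close> for all \<open>\<tau> \<ge> 0\<close>.
  With \<open>\<tau> = K / h powr (4/3)\<close> one has \<open>h\<^sup>4\<tau>\<^sup>3 = K\<^sup>3\<close>, so for \<open>K\<close> large the potential is absorbed;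
  the gradient is then recovered by integrating \<open>w u \<bullet> \<Delta>u\<close> by parts, at the price of the factor
  \<open>h\<^sup>2\<tau>\<^sup>2 = K\<^sup>2 / h powr (2/3)\<close>.
\<close>

section \<open>Directional derivatives\<close>

text \<open>The derivative is a relation between functions on the whole space along a single
  direction \<open>b\<close>, so that product rules and integration by parts reduce to calculus in
  one real variable.\<close>

definition has_dir_deriv ::
    "('a::real_normed_vector \<Rightarrow> 'b::real_normed_vector) \<Rightarrow> ('a \<Rightarrow> 'b) \<Rightarrow> 'a \<Rightarrow> bool" where
  "has_dir_deriv f f' b \<longleftrightarrow>
     (\<forall>x. ((\<lambda>t. f (x + t *\<^sub>R b)) has_vector_derivative f' x) (at 0))"

text \<open>The definition ranges over all base points: use it at \<open>x + t *\<^sub>R b\<close>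
  and shift the parameter by \<open>t\<close>.\<close>

lemma has_dir_deriv_line:
  assumes "has_dir_deriv f f' b"
  shows "((\<lambda>t. f (x + t *\<^sub>R b)) has_vector_derivative f' (x + t *\<^sub>R b)) (at t)"
proof -
  have "((\<lambda>s. f ((x + t *\<^sub>R b) + s *\<^sub>R b)) has_vector_derivative f' (x + t *\<^sub>R b)) (at 0)"
    using assms by (simp add: has_dir_deriv_def)
  then have "(((\<lambda>s. f ((x + t *\<^sub>R b) + s *\<^sub>R b)) \<circ> (\<lambda>r. r - t)) has_vector_derivative
      1 *\<^sub>R f' (x + t *\<^sub>R b)) (at t)"
    by (intro vector_diff_chain_at) (auto intro!: derivative_eq_intros)
  then show ?thesis
    by (simp add: o_def algebra_simps flip: scaleR_add_left)
qed

lemma has_dir_deriv_const: "has_dir_deriv (\<lambda>x. c) (\<lambda>x. 0) b"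
  by (simp add: has_dir_deriv_def)

lemma has_dir_deriv_add:
  "has_dir_deriv f f' b \<Longrightarrow> has_dir_deriv g g' b \<Longrightarrow>
    has_dir_deriv (\<lambda>x. f x + g x) (\<lambda>x. f' x + g' x) b"
  by (auto simp: has_dir_deriv_def intro!: has_vector_derivative_add)

lemma has_dir_deriv_sum:
  "(\<And>i. i \<in> A \<Longrightarrow> has_dir_deriv (f i) (f' i) b) \<Longrightarrow>
    has_dir_deriv (\<lambda>x. \<Sum>i\<in>A. f i x) (\<lambda>x. \<Sum>i\<in>A. f' i x) b"
  by (auto simp: has_dir_deriv_def intro!: has_vector_derivative_sum)

lemma (in bounded_bilinear) has_dir_deriv:
  "has_dir_deriv f f' b \<Longrightarrow> has_dir_deriv g g' b \<Longrightarrow>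
    has_dir_deriv (\<lambda>x. prod (f x) (g x)) (\<lambda>x. prod (f x) (g' x) + prod (f' x) (g x)) b"
  unfolding has_dir_deriv_def
  by (intro allI, drule spec, drule spec, drule (1) has_vector_derivative, simp)

lemmas has_dir_deriv_inner = bounded_bilinear.has_dir_deriv[OF bounded_bilinear_inner]
lemmas has_dir_deriv_scaleR = bounded_bilinear.has_dir_deriv[OF bounded_bilinear_scaleR]
lemmas has_dir_deriv_mult = bounded_bilinear.has_dir_deriv[OF bounded_bilinear_mult]

lemma has_dir_deriv_cong:
  "has_dir_deriv f f' b \<Longrightarrow> (\<And>x. f' x = g x) \<Longrightarrow> has_dir_deriv f g b"
  by (simp add: has_dir_deriv_def)

lemma has_dir_deriv_partial:
  assumes "\<And>x. f differentiable (at x)"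
  shows "has_dir_deriv f (partial b f) b"
  unfolding has_dir_deriv_def partial_def
proof
  fix x
  \<comment> \<open>The base point is written as \<open>x + 0 *\<^sub>R b\<close> to match the inner
    function of the chain rule at 0.\<close>
  have f: "(f has_derivative frechet_derivative f (at x)) (at (x + 0 *\<^sub>R b))"
    using assms[of x] by (simp add: frechet_derivative_works)
  have g: "((\<lambda>t. x + t *\<^sub>R b) has_derivative (\<lambda>t. t *\<^sub>R b)) (at 0)"
    by (auto intro!: derivative_eq_intros)
  have "((\<lambda>t. f (x + t *\<^sub>R b)) has_derivative (\<lambda>t. frechet_derivative f (at x) (t *\<^sub>R b))) (at 0)"
    using diff_chain_at[OF g f] by (simp add: o_def)
  then show "((\<lambda>t. f (x + t *\<^sub>R b)) has_vector_derivative frechet_derivative f (at x) b) (at 0)"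
    unfolding has_vector_derivative_def
    using linear_frechet_derivative[OF assms[of x]] by (simp add: linear_cmul)
qed

text \<open>The complement of \<open>K\<close> is open, so near parameter 0 the line through
  \<open>x\<close> stays where \<open>f\<close> is 0; derivatives along the line are unique.\<close>

lemma has_dir_deriv_zero_outside:
  assumes f: "has_dir_deriv f f' b" and K: "closed K" and z: "\<And>x. x \<notin> K \<Longrightarrow> f x = 0"
    and x: "x \<notin> K"
  shows "f' x = 0"
proof -
  have "open ((\<lambda>t::real. x + t *\<^sub>R b) -` (- K))"
    by (intro open_vimage continuous_intros) (use K in auto)
  moreover have "0 \<in> (\<lambda>t::real. x + t *\<^sub>R b) -` (- K)" using x by simp
  ultimately have "((\<lambda>t. f (x + t *\<^sub>R b)) has_vector_derivative 0) (at 0)"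
    by (rule has_vector_derivative_transform_within_open[OF has_vector_derivative_const[of 0]])
      (auto simp: z)
  then show ?thesis
    using f vector_derivative_unique_at unfolding has_dir_deriv_def by blast
qed

section \<open>Symmetry of mixed second derivatives\<close>

text \<open>Two applications of the mean value theorem: in direction \<open>b\<close> to the
  difference \<open>G\<close> of \<open>f\<close> over the step \<open>d\<close> in direction
  \<open>c\<close>, then in direction \<open>c\<close> to \<open>fb\<close>.\<close>

lemma second_difference:
  fixes f :: "'a::real_normed_vector \<Rightarrow> real"
  assumes fb: "has_dir_deriv f fb b" and fbc: "has_dir_deriv fb fbc c" and d: "0 < d"
  obtains s t where "0 < s" "s < d" "0 < t" "t < d"
    "f (x + d *\<^sub>R b + d *\<^sub>R c) - f (x + d *\<^sub>R b) - f (x + d *\<^sub>R c) + f x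
      = d\<^sup>2 * fbc (x + s *\<^sub>R b + t *\<^sub>R c)"
proof -
  define G where "G s = f ((x + d *\<^sub>R c) + s *\<^sub>R b) - f (x + s *\<^sub>R b)" for s
  have "DERIV G s :> fb ((x + d *\<^sub>R c) + s *\<^sub>R b) - fb (x + s *\<^sub>R b)" for s
    unfolding G_def
    using has_dir_deriv_line[OF fb, of "x + d *\<^sub>R c" s] has_dir_deriv_line[OF fb, of x s]
    by (auto simp: has_real_derivative_iff_has_vector_derivative
        intro!: has_vector_derivative_diff)
  then obtain s where s: "0 < s" "s < d"
    "G d - G 0 = (d - 0) * (fb ((x + d *\<^sub>R c) + s *\<^sub>R b) - fb (x + s *\<^sub>R b))"
    using MVT2[OF d, of G "\<lambda>s. fb ((x + d *\<^sub>R c) + s *\<^sub>R b) - fb (x + s *\<^sub>R b)"] by blast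
  have "DERIV (\<lambda>t. fb ((x + s *\<^sub>R b) + t *\<^sub>R c)) t :> fbc ((x + s *\<^sub>R b) + t *\<^sub>R c)" for t
    using has_dir_deriv_line[OF fbc]
    by (auto simp: has_real_derivative_iff_has_vector_derivative)
  then obtain t where t: "0 < t" "t < d"
    "fb ((x + s *\<^sub>R b) + d *\<^sub>R c) - fb ((x + s *\<^sub>R b) + 0 *\<^sub>R c)
      = (d - 0) * fbc ((x + s *\<^sub>R b) + t *\<^sub>R c)"
    using MVT2[OF d, of "\<lambda>t. fb ((x + s *\<^sub>R b) + t *\<^sub>R c)"
        "\<lambda>t. fbc ((x + s *\<^sub>R b) + t *\<^sub>R c)"] by blast
  have "f (x + d *\<^sub>R b + d *\<^sub>R c) - f (x + d *\<^sub>R b) - f (x + d *\<^sub>R c) + f x = G d - G 0"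
    by (simp add: G_def algebra_simps)
  also have "\<dots> = d * (fb ((x + s *\<^sub>R b) + d *\<^sub>R c) - fb ((x + s *\<^sub>R b) + 0 *\<^sub>R c))"
    using s(3) by (simp add: algebra_simps)
  also have "\<dots> = d\<^sup>2 * fbc (x + s *\<^sub>R b + t *\<^sub>R c)"
    using t(3) by (simp add: power2_eq_square)
  finally show ?thesis using that s t by blast
qed

text \<open>The second difference over the parallelogram with edges along \<open>b\<close> and
  \<open>c\<close> is symmetric in the two directions, so it is expressed both through
  \<open>fbc\<close> and through \<open>fcb\<close>. As the step tends to 0 the intermediate points
  tend to \<open>x\<close>, and continuity concludes.\<close>

lemma mixed_dir_deriv_commute_real:
  fixes f :: "'a::real_normed_vector \<Rightarrow> real"
  assumes fb: "has_dir_deriv f fb b" and fbc: "has_dir_deriv fb fbc c"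
    and fc: "has_dir_deriv f fc c" and fcb: "has_dir_deriv fc fcb b"
    and cont: "continuous_on UNIV fbc" "continuous_on UNIV fcb"
  shows "fbc x = fcb x"
proof -
  define d where "d n = inverse (real (Suc n))" for n
  have d: "d n > 0" for n by (simp add: d_def)
  have "\<exists>s t s' t'. 0 < s \<and> s < d n \<and> 0 < t \<and> t < d n \<and> 0 < s' \<and> s' < d n \<and> 0 < t' \<and> t' < d n \<and>
      fbc (x + s *\<^sub>R b + t *\<^sub>R c) = fcb (x + s' *\<^sub>R b + t' *\<^sub>R c)" for n
  proof -
    obtain s t where 1: "0 < s" "s < d n" "0 < t" "t < d n"
      "f (x + d n *\<^sub>R b + d n *\<^sub>R c) - f (x + d n *\<^sub>R b) - f (x + d n *\<^sub>R c) + f x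
        = (d n)\<^sup>2 * fbc (x + s *\<^sub>R b + t *\<^sub>R c)"
      using second_difference[OF fb fbc d] by blast
    obtain t' s' where 2: "0 < t'" "t' < d n" "0 < s'" "s' < d n"
      "f (x + d n *\<^sub>R c + d n *\<^sub>R b) - f (x + d n *\<^sub>R c) - f (x + d n *\<^sub>R b) + f x
        = (d n)\<^sup>2 * fcb (x + t' *\<^sub>R c + s' *\<^sub>R b)"
      using second_difference[OF fc fcb d] by blast
    have "(d n)\<^sup>2 * fbc (x + s *\<^sub>R b + t *\<^sub>R c) = (d n)\<^sup>2 * fcb (x + t' *\<^sub>R c + s' *\<^sub>R b)"
      unfolding 1(5)[symmetric] 2(5)[symmetric]
      by (simp only: add.assoc add.commute[of "d n *\<^sub>R c"])
    then have "fbc (x + s *\<^sub>R b + t *\<^sub>R c) = fcb (x + s' *\<^sub>R b + t' *\<^sub>R c)"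
      using d[of n] by (simp add: add.assoc add.commute[of "t' *\<^sub>R c"])
    then show ?thesis using 1 2 by blast
  qed
  then obtain s t s' t' where st: "\<And>n. 0 < s n \<and> s n < d n \<and> 0 < t n \<and> t n < d n \<and>
      0 < s' n \<and> s' n < d n \<and> 0 < t' n \<and> t' n < d n \<and>
      fbc (x + s n *\<^sub>R b + t n *\<^sub>R c) = fcb (x + s' n *\<^sub>R b + t' n *\<^sub>R c)"
    by metis
  have d0: "d \<longlonglongrightarrow> 0" unfolding d_def by (rule LIMSEQ_inverse_real_of_nat)
  have sq: "r \<longlonglongrightarrow> 0" if "\<And>n. 0 < r n \<and> r n < d n" for r
    by (rule tendsto_sandwich[OF _ _ tendsto_const d0])
      (use that in \<open>auto intro!: always_eventually less_imp_le\<close>)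
  have lim: "(\<lambda>n. g (x + r n *\<^sub>R b + q n *\<^sub>R c)) \<longlonglongrightarrow> g x"
    if "continuous_on UNIV g" "r \<longlonglongrightarrow> 0" "q \<longlonglongrightarrow> 0" for g :: "'a \<Rightarrow> real" and r q
  proof -
    have "(\<lambda>n. x + r n *\<^sub>R b + q n *\<^sub>R c) \<longlonglongrightarrow> x + 0 *\<^sub>R b + 0 *\<^sub>R c"
      by (intro tendsto_intros that)
    moreover have "isCont g x"
      using that(1) by (simp add: continuous_on_eq_continuous_at)
    ultimately show ?thesis using isCont_tendsto_compose[of x g] by simp
  qed
  have 1: "(\<lambda>n. fbc (x + s n *\<^sub>R b + t n *\<^sub>R c)) \<longlonglongrightarrow> fbc x"
    by (intro lim cont sq) (use st in auto)
  have 2: "(\<lambda>n. fcb (x + s' n *\<^sub>R b + t' n *\<^sub>R c)) \<longlonglongrightarrow> fcb x"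
    by (intro lim cont sq) (use st in auto)
  show ?thesis using 1 2 st LIMSEQ_unique by simp
qed

text \<open>The mean value theorem in its equality form is a scalar statement, so the real case is
  applied to each component \<open>f x \<bullet> w\<close>.\<close>

lemma mixed_dir_deriv_commute:
  fixes f :: "'a::real_normed_vector \<Rightarrow> 'b::euclidean_space"
  assumes "has_dir_deriv f fb b" "has_dir_deriv fb fbc c"
    and "has_dir_deriv f fc c" "has_dir_deriv fc fcb b"
    and "continuous_on UNIV fbc" "continuous_on UNIV fcb"
  shows "fbc x = fcb x"
proof (rule euclidean_eqI)
  fix w :: 'b
  have D: "has_dir_deriv (\<lambda>x. g x \<bullet> w) (\<lambda>x. g' x \<bullet> w) a" if "has_dir_deriv g g' a" for g g' :: "'a \<Rightarrow> 'b" and a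
    using has_dir_deriv_inner[OF that has_dir_deriv_const[of w]] by simp
  show "fbc x \<bullet> w = fcb x \<bullet> w"
    by (rule mixed_dir_deriv_commute_real[OF D[OF assms(1)] D[OF assms(2)] D[OF assms(3)] D[OF assms(4)]])
      (intro continuous_intros assms)+
qed

section \<open>Integration by parts for compactly supported functions\<close>

lemma integrable_compact_support:
  fixes f :: "'a::euclidean_space \<Rightarrow> 'b::{banach,second_countable_topology}"
  assumes f: "continuous_on UNIV f" and K: "compact K" and z: "\<And>x. x \<notin> K \<Longrightarrow> f x = 0"
  shows "integrable lborel f"
proof -
  have "integrable lborel (\<lambda>x. indicator K x *\<^sub>R f x)"
    by (rule borel_integrable_compact[OF K]) (rule continuous_on_subset[OF f], simp)
  moreover have "(\<lambda>x. indicator K x *\<^sub>R f x) = f"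
    by (auto simp: indicator_def z)
  ultimately show ?thesis by simp
qed

lemma integral_lborel_translate:
  fixes f :: "'a::euclidean_space \<Rightarrow> real"
  assumes "f \<in> borel_measurable borel"
  shows "(\<integral>x. f (x + a) \<partial>lborel) = (\<integral>x. f x \<partial>lborel)"
proof -
  have "(\<integral>x. f x \<partial>lborel) = (\<integral>x. f x \<partial>distr lborel borel ((+) a))"
    by (simp add: lborel_distr_plus)
  also have "\<dots> = (\<integral>x. f (a + x) \<partial>lborel)"
    by (rule integral_distr) (use assms in auto)
  finally show ?thesis by (simp add: add.commute)
qed

text \<open>By translation invariance the difference quotients of \<open>f\<close> have integral 0,
  and dominated convergence carries this over to \<open>f'\<close>. Every integration by parts below
  applies this fact to a product.\<close>

lemma integral_dir_deriv:
  fixes f :: "'a::euclidean_space \<Rightarrow> real"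
  assumes D: "has_dir_deriv f f' b" and f: "continuous_on UNIV f" and f': "continuous_on UNIV f'"
    and K: "compact K" and z: "\<And>x. x \<notin> K \<Longrightarrow> f x = 0"
  shows "(\<integral>x. f' x \<partial>lborel) = 0"
proof -
  obtain r where r: "\<And>x. x \<in> K \<Longrightarrow> norm x \<le> r"
    using compact_imp_bounded[OF K] by (auto simp: bounded_iff)
  \<comment> \<open>Enlarging the radius by \<open>norm b\<close> ensures that no step
    \<open>t *\<^sub>R b\<close> with t in [0,1] leads from outside \<open>B\<close> into
    \<open>K\<close>. Since \<open>d n \<le> 1\<close>, all quotients \<open>q n\<close> vanish
    outside \<open>B\<close>.\<close>
  define B where "B = cball (0::'a) (r + norm b)"
  have zB: "f (x + t *\<^sub>R b) = 0" if "x \<notin> B" "0 \<le> t" "t \<le> 1" for x t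
  proof (rule z, rule)
    assume "x + t *\<^sub>R b \<in> K"
    then have "norm (x + t *\<^sub>R b) \<le> r" by (rule r)
    moreover have "norm x \<le> norm (x + t *\<^sub>R b) + norm (t *\<^sub>R b)"
      by (metis add_diff_cancel_right' norm_triangle_ineq4)
    moreover have "norm (t *\<^sub>R b) \<le> norm b"
      using that by (simp add: mult_left_le_one_le)
    ultimately show False using that by (simp add: B_def)
  qed
  have z': "f' x = 0" if "x \<notin> K" for x
    using has_dir_deriv_zero_outside[OF D _ z that] K by (simp add: compact_imp_closed)
  obtain M where M: "\<And>x. x \<in> K \<Longrightarrow> norm (f' x) \<le> M"
    using compact_imp_bounded[OF compact_continuous_image[OF continuous_on_subset[OF f'] K]]
    by (auto simp: bounded_iff)
  define N where "N = max M 0"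
  have N: "norm (f' x) \<le> N" for x
    using M[of x] z'[of x] by (cases "x \<in> K") (auto simp: N_def)
  define d where "d n = inverse (real (Suc n))" for n
  have d: "0 < d n" "d n \<le> 1" for n by (auto simp: d_def field_simps)
  define q where "q n x = (f (x + d n *\<^sub>R b) - f x) / d n" for n x
  have qz: "(\<integral>x. q n x \<partial>lborel) = 0" for n
  proof -
    have i: "integrable lborel f" by (rule integrable_compact_support[OF f K z])
    have "continuous_on UNIV (\<lambda>x. f (x + d n *\<^sub>R b))"
      by (rule continuous_on_compose2[OF f]) (auto intro!: continuous_intros)
    then have j: "integrable lborel (\<lambda>x. f (x + d n *\<^sub>R b))"
      by (rule integrable_compact_support[where K=B])
        (use zB[of _ "d n"] d[of n] in \<open>auto simp: B_def\<close>)
    have "f \<in> borel_measurable borel" by (rule borel_measurable_continuous_onI[OF f])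
    then show ?thesis
      unfolding q_def using integral_lborel_translate[of f "d n *\<^sub>R b"] i j by simp
  qed
  \<comment> \<open>Inside \<open>B\<close> the mean value theorem turns the quotient into a value
    of \<open>f'\<close>; outside \<open>B\<close> both values of \<open>f\<close> are 0.\<close>
  have bnd: "norm (q n x) \<le> indicator B x *\<^sub>R N" for n x
  proof (cases "x \<in> B")
    case True
    have "DERIV (\<lambda>t. f (x + t *\<^sub>R b)) t :> f' (x + t *\<^sub>R b)" for t
      using has_dir_deriv_line[OF D] by (simp add: has_real_derivative_iff_has_vector_derivative)
    then obtain t where "f (x + d n *\<^sub>R b) - f (x + 0 *\<^sub>R b) = (d n - 0) * f' (x + t *\<^sub>R b)"
      using MVT2[OF d(1)[of n], of "\<lambda>t. f (x + t *\<^sub>R b)" "\<lambda>t. f' (x + t *\<^sub>R b)"] by blast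
    then have "q n x = f' (x + t *\<^sub>R b)" using d[of n] by (simp add: q_def)
    then show ?thesis using N True by simp
  next
    case False
    then have "q n x = 0"
      using zB[OF False, of "d n"] zB[OF False, of 0] d[of n] by (simp add: q_def)
    then show ?thesis using False by simp
  qed
  have lim: "(\<lambda>n. q n x) \<longlonglongrightarrow> f' x" for x
  proof -
    have "DERIV (\<lambda>t. f (x + t *\<^sub>R b)) 0 :> f' x"
      using D by (simp add: has_dir_deriv_def has_real_derivative_iff_has_vector_derivative)
    then have "((\<lambda>t. (f (x + t *\<^sub>R b) - f x) / t) \<longlongrightarrow> f' x) (at 0)"
      by (simp add: has_field_derivative_iff)
    moreover have "filterlim d (at 0) sequentially"
      unfolding filterlim_at d_def
      by (auto simp del: of_nat_Suc intro: LIMSEQ_inverse_real_of_nat)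
    ultimately show ?thesis
      unfolding q_def by (rule filterlim_compose)
  qed
  have "(\<lambda>n. \<integral>x. q n x \<partial>lborel) \<longlonglongrightarrow> (\<integral>x. f' x \<partial>lborel)"
  proof (rule integral_dominated_convergence[where w="\<lambda>x. indicator B x *\<^sub>R N"])
    show "f' \<in> borel_measurable lborel"
      using borel_measurable_continuous_onI[OF f'] by simp
    show "q n \<in> borel_measurable lborel" for n
    proof -
      have "continuous_on UNIV (q n)"
        unfolding q_def using d[of n]
        by (auto intro!: continuous_intros continuous_on_compose2[OF f])
      then show ?thesis using borel_measurable_continuous_onI by simp
    qed
    show "integrable lborel (\<lambda>x. indicator B x *\<^sub>R N)"
      by (rule borel_integrable_compact) (auto simp: B_def)
  qed (use lim bnd in auto)
  then show ?thesis using qz LIMSEQ_unique[OF tendsto_const] by (simp add: LIMSEQ_const_iff)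
qed

section \<open>The Carleman estimate for the Laplacian\<close>

lemma has_dir_deriv_linear: "has_dir_deriv (\<lambda>x. x \<bullet> e + c) (\<lambda>x. b \<bullet> e) b"
  unfolding has_dir_deriv_def
  by (auto intro!: derivative_eq_intros simp: inner_add_left
      simp flip: has_real_derivative_iff_has_vector_derivative)

text \<open>The coefficients \<open>b \<bullet> e\<close> are Kronecker deltas. They arise because
  the weight depends on \<open>x \<bullet> e\<close> alone.\<close>

lemma sum_Basis_inner:
  fixes f :: "'a::euclidean_space \<Rightarrow> 'b::real_vector"
  assumes "e \<in> Basis"
  shows "(\<Sum>b\<in>Basis. (b \<bullet> e) *\<^sub>R f b) = f e"
proof -
  have "(\<Sum>b\<in>Basis. (b \<bullet> e) *\<^sub>R f b) = (\<Sum>b\<in>Basis. if b = e then f b else 0)"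
    by (rule sum.cong) (use assms in \<open>auto simp: inner_Basis\<close>)
  then show ?thesis using assms by simp
qed

text \<open>The vector under the norm on the right is \<open>S + A\<close>, and its squared norm is
  pointwise at least \<open>2 * (S \<bullet> A)\<close>. Four integrations by parts show that the
  integral of \<open>2 * (S \<bullet> A)\<close> is the left-hand side plus
  \<open>4 * \<tau>\<close> times the integral of the squared norm of \<open>g e\<close>; the latter
  is nonnegative and is dropped.\<close>

lemma conjugated_carleman:
  fixes v :: "'a::euclidean_space \<Rightarrow> 'b::euclidean_space" and e :: 'a and \<tau> c :: real
  defines "s \<equiv> \<lambda>x. x \<bullet> e + c"
  assumes e: "e \<in> Basis" and \<tau>: "0 \<le> \<tau>"
    and v: "\<And>b. b \<in> Basis \<Longrightarrow> has_dir_deriv v (g b) b"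
    and g: "\<And>b c. b \<in> Basis \<Longrightarrow> c \<in> Basis \<Longrightarrow> has_dir_deriv (g b) (H b c) c"
    and cv: "continuous_on UNIV v" and cg: "\<And>b. b \<in> Basis \<Longrightarrow> continuous_on UNIV (g b)"
    and cH: "\<And>b c. b \<in> Basis \<Longrightarrow> c \<in> Basis \<Longrightarrow> continuous_on UNIV (H b c)"
    and K: "compact K" and z: "\<And>x. x \<notin> K \<Longrightarrow> v x = 0"
  shows "4 * \<tau>^3 * (\<integral>x. (s x)\<^sup>2 * (norm (v x))\<^sup>2 \<partial>lborel)
    \<le> (\<integral>x. (norm ((\<Sum>b\<in>Basis. H b b x) + (\<tau>\<^sup>2 * (s x)\<^sup>2) *\<^sub>R v x
          - (2 * \<tau> * s x) *\<^sub>R g e x - \<tau> *\<^sub>R v x))\<^sup>2 \<partial>lborel)"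
proof -
  have clK: "closed K" using K by (rule compact_imp_closed)
  have zg: "g b x = 0" if "b \<in> Basis" "x \<notin> K" for b x
    using has_dir_deriv_zero_outside[OF v[OF that(1)] clK z that(2)] .
  have zH: "H b c x = 0" if "b \<in> Basis" "c \<in> Basis" "x \<notin> K" for b c x
    using has_dir_deriv_zero_outside[OF g[OF that(1,2)] clK zg[OF that(1)] that(3)] .
  have sym: "H b c x = H c b x" if "b \<in> Basis" "c \<in> Basis" for b c x
    by (rule mixed_dir_deriv_commute[OF v g v g cH cH]) (use that in auto)
  have cs: "continuous_on UNIV s" unfolding s_def by (intro continuous_intros)
  have Ds: "has_dir_deriv s (\<lambda>x. b \<bullet> e) b" for b unfolding s_def by (rule has_dir_deriv_linear)
  have ee: "e \<bullet> e = 1" using e by simp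
  define \<Lambda> where "\<Lambda> x = (\<Sum>b\<in>Basis. H b b x)" for x
  have c\<Lambda>: "continuous_on UNIV \<Lambda>" unfolding \<Lambda>_def by (intro continuous_intros cH)
  have z\<Lambda>: "\<Lambda> x = 0" if "x \<notin> K" for x unfolding \<Lambda>_def using zH that by simp
  note cont = continuous_intros cv cg cH cs c\<Lambda>
  note zero = z zg zH z\<Lambda>
  \<comment> \<open>Expanding \<open>S \<bullet> A\<close> produces \<open>P2\<close>,
    \<open>P4\<close>, \<open>P6\<close> and \<open>P7\<close>; the others enter through the
    integrations by parts.\<close>
  define P1 where "P1 x = g e x \<bullet> g e x" for x
  define P2 where "P2 x = s x * (\<Lambda> x \<bullet> g e x)" for x
  define P3 where "P3 x = s x * (\<Sum>b\<in>Basis. g b x \<bullet> H b e x)" for x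
  define P4 where "P4 x = \<Lambda> x \<bullet> v x" for x
  define P5 where "P5 x = (\<Sum>b\<in>Basis. g b x \<bullet> g b x)" for x
  define P6 where "P6 x = (s x)\<^sup>2 * (v x \<bullet> v x)" for x
  define P7 where "P7 x = (s x)^3 * (g e x \<bullet> v x)" for x
  note P_defs = P1_def P2_def P3_def P4_def P5_def P6_def P7_def
  have int: "integrable lborel P1" "integrable lborel P2" "integrable lborel P3"
    "integrable lborel P4" "integrable lborel P5" "integrable lborel P6" "integrable lborel P7"
    unfolding P_defs by (rule integrable_compact_support[OF _ K]; (intro cont e)?; simp add: zero e)+
  let ?I = "\<lambda>f. \<integral>x. f x \<partial>lborel"
  \<comment> \<open>Divergence theorem for the field with components
    \<open>s * (g b \<bullet> g e)\<close>; the symmetry \<open>sym\<close> turns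
    \<open>H e b\<close> into \<open>H b e\<close>.\<close>
  have I1: "?I P1 + ?I P2 + ?I P3 = 0"
  proof -
    let ?f = "\<lambda>b x. s x * (g b x \<bullet> H e b x + H b b x \<bullet> g e x) + (b \<bullet> e) * (g b x \<bullet> g e x)"
    have "?I (?f b) = 0" if b: "b \<in> Basis" for b
      by (rule integral_dir_deriv[OF has_dir_deriv_mult[OF Ds has_dir_deriv_inner[OF g[OF b b] g[OF e b]]] _ _ K])
        (use b e in \<open>simp_all add: zero cont\<close>)
    moreover have "integrable lborel (?f b)" if b: "b \<in> Basis" for b
      by (rule integrable_compact_support[OF _ K]) (use b e in \<open>simp_all add: zero cont\<close>)
    ultimately have "?I (\<lambda>x. \<Sum>b\<in>Basis. ?f b x) = 0" by simp
    moreover have "(\<Sum>b\<in>Basis. ?f b x) = P1 x + P2 x + P3 x" for x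
      unfolding P_defs \<Lambda>_def using e sym[OF e]
      by (simp add: sum.distrib sum_Basis_inner[OF e, where 'b=real, simplified] inner_sum_left flip: sum_distrib_left)
        (simp add: algebra_simps)
    ultimately show ?thesis using int by simp
  qed
  \<comment> \<open>Green's identity, from the field with components
    \<open>g b \<bullet> v\<close>.\<close>
  have I2: "?I P4 + ?I P5 = 0"
  proof -
    let ?f = "\<lambda>b x. g b x \<bullet> g b x + H b b x \<bullet> v x"
    have "?I (?f b) = 0" if b: "b \<in> Basis" for b
      by (rule integral_dir_deriv[OF has_dir_deriv_inner[OF g[OF b b] v[OF b]] _ _ K])
        (use b e in \<open>simp_all add: zero cont\<close>)
    moreover have "integrable lborel (?f b)" if b: "b \<in> Basis" for b
      by (rule integrable_compact_support[OF _ K]) (use b e in \<open>simp_all add: zero cont\<close>)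
    ultimately have "?I (\<lambda>x. \<Sum>b\<in>Basis. ?f b x) = 0" by simp
    moreover have "(\<Sum>b\<in>Basis. ?f b x) = P4 x + P5 x" for x
      unfolding P_defs \<Lambda>_def by (simp add: sum.distrib inner_sum_left)
    ultimately show ?thesis using int by simp
  qed
  \<comment> \<open>Integrates the derivative of \<open>s * P5\<close> in direction
    \<open>e\<close>.\<close>
  have I3: "?I P5 + 2 * ?I P3 = 0"
  proof -
    have "?I (\<lambda>x. s x * (\<Sum>b\<in>Basis. g b x \<bullet> H b e x + H b e x \<bullet> g b x) + (e \<bullet> e) * P5 x) = 0"
      unfolding P5_def
      by (rule integral_dir_deriv[OF has_dir_deriv_mult[OF Ds has_dir_deriv_sum[OF has_dir_deriv_inner]] _ _ K])
        (use e in \<open>simp_all add: zero cont g\<close>)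
    moreover have "s x * (\<Sum>b\<in>Basis. g b x \<bullet> H b e x + H b e x \<bullet> g b x) + (e \<bullet> e) * P5 x
        = P5 x + 2 * P3 x" for x
      unfolding P3_def by (simp add: ee sum.distrib inner_commute sum_distrib_left mult_ac)
    ultimately show ?thesis using int by simp
  qed
  \<comment> \<open>Integrates the derivative of \<open>s^3 * (v \<bullet> v)\<close> in direction
    \<open>e\<close>.\<close>
  have I4: "3 * ?I P6 + 2 * ?I P7 = 0"
  proof -
    have "?I (\<lambda>x. (s x * (s x * s x)) * (v x \<bullet> g e x + g e x \<bullet> v x)
        + (s x * (s x * (e \<bullet> e) + (e \<bullet> e) * s x) + (e \<bullet> e) * (s x * s x)) * (v x \<bullet> v x)) = 0"
      by (rule integral_dir_deriv[OF has_dir_deriv_mult[OF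
              has_dir_deriv_mult[OF Ds has_dir_deriv_mult[OF Ds Ds]] has_dir_deriv_inner] _ _ K])
        (use e in \<open>simp_all add: zero cont v\<close>)
    moreover have "(s x * (s x * s x)) * (v x \<bullet> g e x + g e x \<bullet> v x)
        + (s x * (s x * (e \<bullet> e) + (e \<bullet> e) * s x) + (e \<bullet> e) * (s x * s x)) * (v x \<bullet> v x)
        = 3 * P6 x + 2 * P7 x" for x
      unfolding P6_def P7_def
      by (simp add: ee inner_commute power2_eq_square power3_eq_cube algebra_simps)
    ultimately show ?thesis using int by simp
  qed
  have "4 * \<tau>^3 * ?I P6 \<le> 4 * \<tau> * ?I P1 + 4 * \<tau>^3 * ?I P6"
    using \<tau> by (simp add: P1_def)
  also have "\<dots> = - 4 * \<tau> * ?I P2 - 2 * \<tau> * ?I P4 - 4 * \<tau>^3 * ?I P7 - 2 * \<tau>^3 * ?I P6"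
  proof -
    \<comment> \<open>After substitution the two contributions of \<open>P3\<close>, with
      coefficients \<open>4 * \<tau>\<close> and \<open>- 4 * \<tau>\<close>, cancel. The
      \<open>P7\<close> term becomes \<open>6 * \<tau>^3\<close> times the integral of
      \<open>P6\<close>, of which \<open>4 * \<tau>^3\<close> remain.\<close>
    have "?I P2 = - ?I P1 - ?I P3" "?I P4 = 2 * ?I P3" "?I P7 = - (3 / 2) * ?I P6"
      using I1 I2 I3 I4 by linarith+
    then show ?thesis by (simp only:) (simp add: algebra_simps)
  qed
  also have "\<dots> = ?I (\<lambda>x. - 4 * \<tau> * P2 x - 2 * \<tau> * P4 x - 4 * \<tau>^3 * P7 x - 2 * \<tau>^3 * P6 x)"
    using int by simp
  also have "\<dots> \<le> ?I (\<lambda>x. (norm (\<Lambda> x + (\<tau>\<^sup>2 * (s x)\<^sup>2) *\<^sub>R v x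
          - (2 * \<tau> * s x) *\<^sub>R g e x - \<tau> *\<^sub>R v x))\<^sup>2)"
  proof (rule integral_mono)
    show "integrable lborel (\<lambda>x. - 4 * \<tau> * P2 x - 2 * \<tau> * P4 x - 4 * \<tau>^3 * P7 x - 2 * \<tau>^3 * P6 x)"
      using int by simp
    show "integrable lborel (\<lambda>x. (norm (\<Lambda> x + (\<tau>\<^sup>2 * (s x)\<^sup>2) *\<^sub>R v x
          - (2 * \<tau> * s x) *\<^sub>R g e x - \<tau> *\<^sub>R v x))\<^sup>2)"
      by (rule integrable_compact_support[OF _ K]) (use e in \<open>simp_all add: zero cont\<close>)
    fix x
    \<comment> \<open>Symmetric and antisymmetric parts of the conjugated Laplacian.\<close>
    define S where "S = \<Lambda> x + (\<tau>\<^sup>2 * (s x)\<^sup>2) *\<^sub>R v x"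
    define A where "A = - (2 * \<tau> * s x) *\<^sub>R g e x - \<tau> *\<^sub>R v x"
    have "- 4 * \<tau> * P2 x - 2 * \<tau> * P4 x - 4 * \<tau>^3 * P7 x - 2 * \<tau>^3 * P6 x = 2 * (S \<bullet> A)"
      unfolding P_defs S_def A_def
      by (simp add: inner_add_left inner_diff_right inner_commute[of "v x" "g e x"]
          power2_eq_square power3_eq_cube algebra_simps)
    also have "\<dots> \<le> (norm (S + A))\<^sup>2"
      by (simp add: power2_norm_eq_inner inner_add_left inner_add_right inner_commute)
    also have "S + A = \<Lambda> x + (\<tau>\<^sup>2 * (s x)\<^sup>2) *\<^sub>R v x - (2 * \<tau> * s x) *\<^sub>R g e x - \<tau> *\<^sub>R v x"
      by (simp add: S_def A_def)
    finally show "- 4 * \<tau> * P2 x - 2 * \<tau> * P4 x - 4 * \<tau>^3 * P7 x - 2 * \<tau>^3 * P6 x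
      \<le> (norm (\<Lambda> x + (\<tau>\<^sup>2 * (s x)\<^sup>2) *\<^sub>R v x - (2 * \<tau> * s x) *\<^sub>R g e x - \<tau> *\<^sub>R v x))\<^sup>2" .
  qed
  finally show ?thesis by (simp add: P6_def \<Lambda>_def power2_norm_eq_inner)
qed

lemma has_dir_deriv_exp:
  fixes f :: "'a::real_normed_vector \<Rightarrow> real"
  assumes "has_dir_deriv f f' b"
  shows "has_dir_deriv (\<lambda>x. exp (f x)) (\<lambda>x. f' x * exp (f x)) b"
  using assms unfolding has_dir_deriv_def
  by (auto simp flip: has_real_derivative_iff_has_vector_derivative
      intro!: derivative_eq_intros)

lemma has_dir_deriv_gaussian:
  "has_dir_deriv (\<lambda>x. exp (a * (x \<bullet> e + c)\<^sup>2)) (\<lambda>x. 2 * a * (b \<bullet> e) * (x \<bullet> e + c) * exp (a * (x \<bullet> e + c)\<^sup>2)) b"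
proof -
  note l = has_dir_deriv_linear[of e c b]
  have "has_dir_deriv (\<lambda>x. a * ((x \<bullet> e + c) * (x \<bullet> e + c))) (\<lambda>x. 2 * a * (b \<bullet> e) * (x \<bullet> e + c)) b"
    by (rule has_dir_deriv_cong[OF has_dir_deriv_mult[OF has_dir_deriv_const has_dir_deriv_mult[OF l l]]])
      (simp add: algebra_simps)
  from has_dir_deriv_exp[OF this] show ?thesis by (simp add: power2_eq_square)
qed

text \<open>Apply \<open>conjugated_carleman\<close> to \<open>v = E u\<close>, where
  \<open>E\<close> is the square root of the weight: the conjugated operator then sends
  \<open>v\<close> to \<open>E\<close> times the Laplacian of \<open>u\<close>.\<close>

lemma carleman:
  fixes u :: "'a::euclidean_space \<Rightarrow> 'b::euclidean_space" and e :: 'a and \<tau> c :: real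
  defines "s \<equiv> \<lambda>x. x \<bullet> e + c"
  assumes e: "e \<in> Basis" and \<tau>: "0 \<le> \<tau>"
    and u: "\<And>b. b \<in> Basis \<Longrightarrow> has_dir_deriv u (d b) b"
    and d: "\<And>b c. b \<in> Basis \<Longrightarrow> c \<in> Basis \<Longrightarrow> has_dir_deriv (d b) (D b c) c"
    and cu: "continuous_on UNIV u" and cd: "\<And>b. b \<in> Basis \<Longrightarrow> continuous_on UNIV (d b)"
    and cD: "\<And>b c. b \<in> Basis \<Longrightarrow> c \<in> Basis \<Longrightarrow> continuous_on UNIV (D b c)"
    and K: "compact K" and z: "\<And>x. x \<notin> K \<Longrightarrow> u x = 0"
  shows "4 * \<tau>^3 * (\<integral>x. exp (\<tau> * (s x)\<^sup>2) * (s x)\<^sup>2 * (norm (u x))\<^sup>2 \<partial>lborel)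
    \<le> (\<integral>x. exp (\<tau> * (s x)\<^sup>2) * (norm (\<Sum>b\<in>Basis. D b b x))\<^sup>2 \<partial>lborel)"
proof -
  define E where "E x = exp (\<tau> / 2 * (s x)\<^sup>2)" for x
  have E2: "(E x)\<^sup>2 = exp (\<tau> * (s x)\<^sup>2)" for x
    by (simp add: E_def power2_eq_square flip: exp_add)
  have DE: "has_dir_deriv E (\<lambda>x. \<tau> * (b \<bullet> e) * s x * E x) b" for b
    using has_dir_deriv_gaussian[of "\<tau> / 2" e c b] by (simp add: E_def[abs_def] s_def)
  have Ds: "has_dir_deriv s (\<lambda>x. b \<bullet> e) b" for b unfolding s_def by (rule has_dir_deriv_linear)
  have cs: "continuous_on UNIV s" unfolding s_def by (intro continuous_intros)
  have cE: "continuous_on UNIV E" unfolding E_def by (intro continuous_intros cs)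
  define v where "v x = E x *\<^sub>R u x" for x
  \<comment> \<open>\<open>g\<close> and \<open>H\<close> are the first and second derivatives of
    \<open>v\<close> as the product rule delivers them.\<close>
  define g where "g b x = E x *\<^sub>R (d b x + (\<tau> * (b \<bullet> e) * s x) *\<^sub>R u x)" for b x
  define H where "H b c x = E x *\<^sub>R (D b c x + ((\<tau> * (b \<bullet> e) * s x) *\<^sub>R d c x
      + (\<tau> * (b \<bullet> e) * (c \<bullet> e)) *\<^sub>R u x))
      + (\<tau> * (c \<bullet> e) * s x * E x) *\<^sub>R (d b x + (\<tau> * (b \<bullet> e) * s x) *\<^sub>R u x)" for b c x
  have Dv: "has_dir_deriv v (g b) b" if "b \<in> Basis" for b
    unfolding v_def
    by (rule has_dir_deriv_cong[OF has_dir_deriv_scaleR[OF DE u[OF that]]])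
      (simp add: g_def algebra_simps)
  have Dg: "has_dir_deriv (g b) (H b c) c" if "b \<in> Basis" "c \<in> Basis" for b c
    unfolding g_def
    by (rule has_dir_deriv_cong[OF has_dir_deriv_scaleR[OF DE has_dir_deriv_add[OF d[OF that]
              has_dir_deriv_scaleR[OF has_dir_deriv_mult[OF has_dir_deriv_const Ds] u[OF that(2)]]]]])
      (simp add: H_def)
  have cv: "continuous_on UNIV v" unfolding v_def by (intro continuous_intros cE cu)
  have cg: "continuous_on UNIV (g b)" if "b \<in> Basis" for b
    unfolding g_def by (intro continuous_intros cE cu cd cs that)
  have cH: "continuous_on UNIV (H b c)" if "b \<in> Basis" "c \<in> Basis" for b c
    unfolding H_def by (intro continuous_intros cE cu cd cs cD that)
  have zv: "v x = 0" if "x \<notin> K" for x using z[OF that] by (simp add: v_def)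
  have sumH: "(\<Sum>b\<in>Basis. H b b x) = E x *\<^sub>R ((\<Sum>b\<in>Basis. D b b x) + (2 * \<tau> * s x) *\<^sub>R d e x
      + (\<tau> + \<tau>\<^sup>2 * (s x)\<^sup>2) *\<^sub>R u x)" for x
  proof -
    have "H b b x = E x *\<^sub>R D b b x + (2 * \<tau> * s x * E x) *\<^sub>R ((b \<bullet> e) *\<^sub>R d b x)
        + ((\<tau> + \<tau>\<^sup>2 * (s x)\<^sup>2) * E x) *\<^sub>R ((b \<bullet> e) *\<^sub>R ((b \<bullet> e) *\<^sub>R u x))" for b
      by (simp add: H_def algebra_simps power2_eq_square) (simp add: mult_ac flip: scaleR_add_left)
    note HH = this
    have "(\<Sum>b\<in>Basis. H b b x) = E x *\<^sub>R (\<Sum>b\<in>Basis. D b b x) + (2 * \<tau> * s x * E x) *\<^sub>R d e x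
        + ((\<tau> + \<tau>\<^sup>2 * (s x)\<^sup>2) * E x) *\<^sub>R ((e \<bullet> e) *\<^sub>R u x)"
      by (simp only: HH sum.distrib scaleR_sum_right[symmetric] sum_Basis_inner[OF e])
    then show ?thesis using e by (simp add: algebra_simps)
  qed
  have ee: "e \<bullet> e = 1" using e by simp
  \<comment> \<open>Undoing the conjugation: the terms in \<open>d e\<close> and in
    \<open>\<tau> u\<close> cancel in pairs, and the terms in
    \<open>\<tau>\<^sup>2 s\<^sup>2 u\<close> have coefficients 1, 1 and -2.\<close>
  have "(\<Sum>b\<in>Basis. H b b x) + (\<tau>\<^sup>2 * (s x)\<^sup>2) *\<^sub>R v x - (2 * \<tau> * s x) *\<^sub>R g e x - \<tau> *\<^sub>R v x
      = E x *\<^sub>R (\<Sum>b\<in>Basis. D b b x)" for x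
    unfolding sumH
    by (simp add: v_def g_def ee algebra_simps power2_eq_square scaleR_2 flip: scaleR_add_left)
  note eq = this
  have "4 * \<tau>^3 * (\<integral>x. (s x)\<^sup>2 * (norm (v x))\<^sup>2 \<partial>lborel)
    \<le> (\<integral>x. (norm (E x *\<^sub>R (\<Sum>b\<in>Basis. D b b x)))\<^sup>2 \<partial>lborel)"
    unfolding eq[symmetric] s_def
    by (rule conjugated_carleman[where K=K]) (fact e \<tau> K | rule Dv Dg cv cg cH zv; assumption?)+
  then show ?thesis
    by (simp add: v_def power_mult_distrib E2 mult.commute mult.left_commute)
qed

section \<open>Recovering the gradient\<close>

text \<open>Integrating the divergence of the field \<open>w * (u \<bullet> d b)\<close> expresses
  the gradient integral through \<open>u \<bullet> \<Lambda>\<close> and a term from the derivative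
  of the weight. Young's inequality handles the former with the free parameter \<alpha> and bounds
  the latter by half the gradient integral plus a multiple of the weighted norm of
  \<open>u\<close>.\<close>

lemma weighted_gradient_bound:
  fixes u :: "'a::euclidean_space \<Rightarrow> 'b::euclidean_space" and e :: 'a and \<tau> c :: real
  defines "s \<equiv> \<lambda>x. x \<bullet> e + c"
  assumes e: "e \<in> Basis" and \<alpha>: "0 < \<alpha>"
    and u: "\<And>b. b \<in> Basis \<Longrightarrow> has_dir_deriv u (d b) b"
    and d: "\<And>b. b \<in> Basis \<Longrightarrow> has_dir_deriv (d b) (D b) b"
    and cu: "continuous_on UNIV u" and cd: "\<And>b. b \<in> Basis \<Longrightarrow> continuous_on UNIV (d b)"
    and cD: "\<And>b. b \<in> Basis \<Longrightarrow> continuous_on UNIV (D b)"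
    and K: "compact K" and z: "\<And>x. x \<notin> K \<Longrightarrow> u x = 0"
    and S: "\<And>x. x \<in> K \<Longrightarrow> \<bar>s x\<bar> \<le> S"
  shows "(\<integral>x. exp (\<tau> * (s x)\<^sup>2) * (\<Sum>b\<in>Basis. (norm (d b x))\<^sup>2) \<partial>lborel)
    \<le> (\<alpha> + 4 * \<tau>\<^sup>2 * S\<^sup>2) * (\<integral>x. exp (\<tau> * (s x)\<^sup>2) * (norm (u x))\<^sup>2 \<partial>lborel)
      + (\<integral>x. exp (\<tau> * (s x)\<^sup>2) * (norm (\<Sum>b\<in>Basis. D b x))\<^sup>2 \<partial>lborel) / \<alpha>"
proof -
  have clK: "closed K" using K by (rule compact_imp_closed)
  have zd: "d b x = 0" if "b \<in> Basis" "x \<notin> K" for b x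
    using has_dir_deriv_zero_outside[OF u[OF that(1)] clK z that(2)] .
  have zD: "D b x = 0" if "b \<in> Basis" "x \<notin> K" for b x
    using has_dir_deriv_zero_outside[OF d[OF that(1)] clK zd[OF that(1)] that(2)] .
  have cs: "continuous_on UNIV s" unfolding s_def by (intro continuous_intros)
  define w where "w x = exp (\<tau> * (s x)\<^sup>2)" for x
  have cw: "continuous_on UNIV w" unfolding w_def by (intro continuous_intros cs)
  have w0: "w x > 0" for x by (simp add: w_def)
  have Dw: "has_dir_deriv w (\<lambda>x. 2 * \<tau> * (b \<bullet> e) * s x * w x) b" for b
    using has_dir_deriv_gaussian[of \<tau> e c b] by (simp add: w_def[abs_def] s_def)
  define \<Lambda> where "\<Lambda> x = (\<Sum>b\<in>Basis. D b x)" for x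
  have c\<Lambda>: "continuous_on UNIV \<Lambda>" unfolding \<Lambda>_def by (intro continuous_intros cD)
  have z\<Lambda>: "\<Lambda> x = 0" if "x \<notin> K" for x unfolding \<Lambda>_def using zD that by simp
  note cont = continuous_intros cu cd cD cs c\<Lambda> cw
  note zero = z zd zD z\<Lambda>
  define G where "G x = (\<Sum>b\<in>Basis. (norm (d b x))\<^sup>2)" for x
  let ?I = "\<lambda>f. \<integral>x. f x \<partial>lborel"
  have int: "integrable lborel (\<lambda>x. w x * G x)" "integrable lborel (\<lambda>x. w x * (u x \<bullet> \<Lambda> x))"
    "integrable lborel (\<lambda>x. 2 * \<tau> * s x * w x * (u x \<bullet> d e x))"
    "integrable lborel (\<lambda>x. w x * (norm (u x))\<^sup>2)" "integrable lborel (\<lambda>x. w x * (norm (\<Lambda> x))\<^sup>2)"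
    unfolding G_def by (rule integrable_compact_support[OF _ K]; (intro cont e)?; simp add: zero e)+
  let ?f = "\<lambda>b x. w x * (u x \<bullet> D b x + d b x \<bullet> d b x) + (2 * \<tau> * (b \<bullet> e) * s x * w x) * (u x \<bullet> d b x)"
  have "?I (?f b) = 0" if b: "b \<in> Basis" for b
    by (rule integral_dir_deriv[OF has_dir_deriv_mult[OF Dw has_dir_deriv_inner[OF u[OF b] d[OF b]]] _ _ K])
      (use b e in \<open>simp_all add: zero cont\<close>)
  moreover have "integrable lborel (?f b)" if b: "b \<in> Basis" for b
    by (rule integrable_compact_support[OF _ K]) (use b e in \<open>simp_all add: zero cont\<close>)
  ultimately have "?I (\<lambda>x. \<Sum>b\<in>Basis. ?f b x) = 0" by simp
  moreover have "(\<Sum>b\<in>Basis. ?f b x) = w x * G x + w x * (u x \<bullet> \<Lambda> x)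
      + 2 * \<tau> * s x * w x * (u x \<bullet> d e x)" for x
  proof -
    have "(\<Sum>b\<in>Basis. ?f b x) = (\<Sum>b\<in>Basis. w x * (norm (d b x))\<^sup>2 + w x * (u x \<bullet> D b x)
      + 2 * \<tau> * s x * w x * ((b \<bullet> e) * (u x \<bullet> d b x)))"
      by (rule sum.cong) (simp_all add: power2_norm_eq_inner algebra_simps)
    then show ?thesis
      using sum_Basis_inner[OF e, of "\<lambda>b. u x \<bullet> d b x"]
      by (simp add: G_def \<Lambda>_def sum.distrib inner_sum_right flip: sum_distrib_left)
  qed
  ultimately have "?I (\<lambda>x. w x * G x) = ?I (\<lambda>x. - (w x * (u x \<bullet> \<Lambda> x)) - 2 * \<tau> * s x * w x * (u x \<bullet> d e x))"
    using int by simp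
  also have "\<dots> \<le> ?I (\<lambda>x. (\<alpha> / 2 + 2 * \<tau>\<^sup>2 * S\<^sup>2) * (w x * (norm (u x))\<^sup>2)
      + (1 / (2 * \<alpha>)) * (w x * (norm (\<Lambda> x))\<^sup>2) + (1 / 2) * (w x * G x))"
  proof (rule integral_mono)
    show "integrable lborel (\<lambda>x. - (w x * (u x \<bullet> \<Lambda> x)) - 2 * \<tau> * s x * w x * (u x \<bullet> d e x))"
      using int by simp
    show "integrable lborel (\<lambda>x. (\<alpha> / 2 + 2 * \<tau>\<^sup>2 * S\<^sup>2) * (w x * (norm (u x))\<^sup>2)
      + (1 / (2 * \<alpha>)) * (w x * (norm (\<Lambda> x))\<^sup>2) + (1 / 2) * (w x * G x))"
      using int by simp
    fix x
    have y1: "- (u x \<bullet> \<Lambda> x) \<le> \<alpha> / 2 * (norm (u x))\<^sup>2 + 1 / (2 * \<alpha>) * (norm (\<Lambda> x))\<^sup>2"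
    proof -
      have "0 \<le> (norm (\<alpha> *\<^sub>R u x + \<Lambda> x))\<^sup>2 / (2 * \<alpha>)" using \<alpha> by simp
      also have "\<dots> = \<alpha> / 2 * (norm (u x))\<^sup>2 + 1 / (2 * \<alpha>) * (norm (\<Lambda> x))\<^sup>2 + u x \<bullet> \<Lambda> x"
        using \<alpha> by (simp add: power2_norm_eq_inner inner_add_left inner_add_right inner_commute field_simps)
      finally show ?thesis by simp
    qed
    \<comment> \<open>The bound \<open>S\<close> is available on \<open>K\<close> only; off
      \<open>K\<close> both sides are 0.\<close>
    have y2: "- (2 * \<tau> * s x * (u x \<bullet> d e x)) \<le> 2 * \<tau>\<^sup>2 * S\<^sup>2 * (norm (u x))\<^sup>2 + 1 / 2 * G x"
    proof (cases "x \<in> K")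
      case True
      have "0 \<le> (norm ((2 * \<tau> * s x) *\<^sub>R u x + d e x))\<^sup>2 / 2" by simp
      also have "\<dots> = 2 * \<tau>\<^sup>2 * (s x)\<^sup>2 * (norm (u x))\<^sup>2 + 2 * \<tau> * s x * (u x \<bullet> d e x) + 1 / 2 * (norm (d e x))\<^sup>2"
        using dot_norm[of "(2 * \<tau> * s x) *\<^sub>R u x" "d e x"] by (simp add: power_mult_distrib field_simps)
      finally have "- (2 * \<tau> * s x * (u x \<bullet> d e x))
          \<le> 2 * \<tau>\<^sup>2 * (s x)\<^sup>2 * (norm (u x))\<^sup>2 + 1 / 2 * (norm (d e x))\<^sup>2" by simp
      also have "(norm (d e x))\<^sup>2 \<le> G x"
        unfolding G_def by (rule member_le_sum[OF e]) auto
      also have "(s x)\<^sup>2 \<le> S\<^sup>2"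
        using S[OF True] by (metis abs_ge_zero power2_abs power_mono)
      finally show ?thesis by (simp add: mult_left_mono mult_right_mono)
    next
      case False
      then show ?thesis by (simp add: zero G_def)
    qed
    have "- (w x * (u x \<bullet> \<Lambda> x)) - 2 * \<tau> * s x * w x * (u x \<bullet> d e x)
      = w x * (- (u x \<bullet> \<Lambda> x) + (- (2 * \<tau> * s x * (u x \<bullet> d e x))))"
      by (simp add: algebra_simps)
    also have "\<dots> \<le> w x * ((\<alpha> / 2 * (norm (u x))\<^sup>2 + 1 / (2 * \<alpha>) * (norm (\<Lambda> x))\<^sup>2)
        + (2 * \<tau>\<^sup>2 * S\<^sup>2 * (norm (u x))\<^sup>2 + 1 / 2 * G x))"
      using w0[of x] by (intro mult_left_mono add_mono y1 y2) simp
    finally show "- (w x * (u x \<bullet> \<Lambda> x)) - 2 * \<tau> * s x * w x * (u x \<bullet> d e x)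
      \<le> (\<alpha> / 2 + 2 * \<tau>\<^sup>2 * S\<^sup>2) * (w x * (norm (u x))\<^sup>2)
      + (1 / (2 * \<alpha>)) * (w x * (norm (\<Lambda> x))\<^sup>2) + (1 / 2) * (w x * G x)"
      by (simp add: algebra_simps)
  qed
  also have "\<dots> = (\<alpha> / 2 + 2 * \<tau>\<^sup>2 * S\<^sup>2) * ?I (\<lambda>x. w x * (norm (u x))\<^sup>2)
      + (1 / (2 * \<alpha>)) * ?I (\<lambda>x. w x * (norm (\<Lambda> x))\<^sup>2) + (1 / 2) * ?I (\<lambda>x. w x * G x)"
    using int by simp
  \<comment> \<open>Half of the gradient integral moves to the left; doubling then gives the stated
    constants.\<close>
  finally show ?thesis
    using \<alpha> by (simp add: w_def G_def \<Lambda>_def field_simps)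
qed

section \<open>Absorbing a bounded potential\<close>

text \<open>The Carleman estimate gains \<open>4 * h^4 * \<tau>^3\<close> on the weighted norm of
  \<open>u\<close>, while passing from the Laplacian to the full operator costs
  \<open>2 * M\<^sup>2\<close>. The first size condition makes the gain at least twice the cost, and
  the second makes the remaining gain large enough to control the norm itself.\<close>

lemma perturbed_carleman:
  fixes u W :: "'a::euclidean_space \<Rightarrow> complex" and e :: 'a and \<tau> c h M :: real
  defines "s \<equiv> \<lambda>x. x \<bullet> e + c"
  assumes e: "e \<in> Basis" and \<tau>: "0 \<le> \<tau>" and h: "0 < h"
    and M: "M\<^sup>2 \<le> h^4 * \<tau>^3" and one: "1 \<le> h^4 * \<tau>^3"
    and W: "W \<in> borel_measurable lebesgue" and WM: "AE x in lebesgue. norm (W x) \<le> M"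
    and sm: "smooth u" and K: "compact K" and z: "\<And>x. x \<notin> K \<Longrightarrow> u x = 0"
    and s1: "\<And>x. x \<in> K \<Longrightarrow> 1 \<le> s x" and S: "\<And>x. x \<in> K \<Longrightarrow> \<bar>s x\<bar> \<le> S"
  shows "(\<integral>x. exp (\<tau> * (s x)\<^sup>2) * ((norm (u x))\<^sup>2 + (h * grad_norm u x)\<^sup>2) \<partial>lebesgue)
    \<le> (6 + 4 * (h\<^sup>2 * \<tau>\<^sup>2) * S\<^sup>2) *
      (\<integral>x. exp (\<tau> * (s x)\<^sup>2) * (norm (schroedinger h W u x))\<^sup>2 \<partial>lebesgue)"
proof -
  have "Ck 2 u" using sm by (simp add: smooth_def)
  then have du: "\<And>x. u differentiable (at x)"
    and dp: "\<And>b x. b \<in> Basis \<Longrightarrow> partial b u differentiable (at x)"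
    and cD: "\<And>b c. b \<in> Basis \<Longrightarrow> c \<in> Basis \<Longrightarrow> continuous_on UNIV (partial c (partial b u))"
    by (auto simp: numeral_2_eq_2)
  have cu: "continuous_on UNIV u"
    using du by (simp add: continuous_on_eq_continuous_at differentiable_imp_continuous_within)
  have cd: "continuous_on UNIV (partial b u)" if "b \<in> Basis" for b
    using dp[OF that] by (simp add: continuous_on_eq_continuous_at differentiable_imp_continuous_within)
  have Du: "has_dir_deriv u (partial b u) b" for b
    by (rule has_dir_deriv_partial[OF du])
  have Dd: "has_dir_deriv (partial b u) (partial c (partial b u)) c" if "b \<in> Basis" for b c
    by (rule has_dir_deriv_partial[OF dp[OF that]])
  have clK: "closed K" using K by (rule compact_imp_closed)
  have zd: "partial b u x = 0" if "b \<in> Basis" "x \<notin> K" for b x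
    using has_dir_deriv_zero_outside[OF Du clK z that(2)] .
  have zL: "laplacian u x = 0" if "x \<notin> K" for x
    unfolding laplacian_def
    using has_dir_deriv_zero_outside[OF Dd clK zd that] by simp
  have cL: "continuous_on UNIV (laplacian u)"
    unfolding laplacian_def[abs_def] by (intro continuous_intros cD)
  have cs: "continuous_on UNIV s" unfolding s_def by (intro continuous_intros)
  define w where "w x = exp (\<tau> * (s x)\<^sup>2)" for x
  have cw: "continuous_on UNIV w" unfolding w_def by (intro continuous_intros cs)
  have w0: "w x > 0" for x by (simp add: w_def)
  have grad: "(grad_norm u x)\<^sup>2 = (\<Sum>b\<in>Basis. (norm (partial b u x))\<^sup>2)" for x
    by (simp add: grad_norm_def sum_nonneg)
  define A where "A = (\<integral>x. w x * (norm (u x))\<^sup>2 \<partial>lborel)"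
  define G where "G = (\<integral>x. w x * (grad_norm u x)\<^sup>2 \<partial>lborel)"
  define B where "B = (\<integral>x. w x * (norm (laplacian u x))\<^sup>2 \<partial>lborel)"
  define F where "F = (\<integral>x. w x * (norm (schroedinger h W u x))\<^sup>2 \<partial>lebesgue)"
  note cont = continuous_intros cu cd cD cs cL cw
  note zero = z zd zL
  have contA: "continuous_on UNIV (\<lambda>x. w x * (norm (u x))\<^sup>2)"
    and contG: "continuous_on UNIV (\<lambda>x. w x * (grad_norm u x)\<^sup>2)"
    and contB: "continuous_on UNIV (\<lambda>x. w x * (norm (laplacian u x))\<^sup>2)"
    unfolding grad by (intro cont; assumption)+
  have intA: "integrable lborel (\<lambda>x. w x * (norm (u x))\<^sup>2)"
    by (rule integrable_compact_support[OF contA K]) (simp add: zero)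
  have intG: "integrable lborel (\<lambda>x. w x * (grad_norm u x)\<^sup>2)"
    by (rule integrable_compact_support[OF contG K]) (simp add: grad zero)
  have intB: "integrable lborel (\<lambda>x. w x * (norm (laplacian u x))\<^sup>2)"
    by (rule integrable_compact_support[OF contB K]) (simp add: zero)
  \<comment> \<open>Only integrands containing \<open>W\<close> have to stay over
    \<open>lebesgue\<close>; continuous ones move to \<open>lborel\<close>, where the previous
    estimates are stated.\<close>
  have leb: "(\<integral>x. f x \<partial>lebesgue) = (\<integral>x. f x \<partial>lborel)" "integrable lborel f \<Longrightarrow> integrable lebesgue f"
    if "continuous_on UNIV f" for f :: "'a \<Rightarrow> real"
    using borel_measurable_continuous_onI[OF that]
    by (simp_all add: integral_completion integrable_completion)
  have A0: "0 \<le> A" unfolding A_def by (rule integral_nonneg_AE) (use w0 in \<open>simp add: less_imp_le\<close>)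

  have carl: "4 * \<tau>^3 * A \<le> B"
  proof -
    have "A \<le> (\<integral>x. w x * (s x)\<^sup>2 * (norm (u x))\<^sup>2 \<partial>lborel)"
      unfolding A_def
    proof (rule integral_mono[OF intA])
      show "integrable lborel (\<lambda>x. w x * (s x)\<^sup>2 * (norm (u x))\<^sup>2)"
        by (rule integrable_compact_support[OF _ K]; (intro cont)?; simp add: zero)
      fix x
      show "w x * (norm (u x))\<^sup>2 \<le> w x * (s x)\<^sup>2 * (norm (u x))\<^sup>2"
      proof (cases "x \<in> K")
        case True
        then have "1 \<le> (s x)\<^sup>2" using s1 by (simp add: one_le_power)
        then have "w x * 1 \<le> w x * (s x)\<^sup>2" using w0[of x] by (intro mult_left_mono) auto
        then show ?thesis by (intro mult_right_mono) auto
      qed (simp add: z)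
    qed
    then have "4 * \<tau>^3 * A \<le> 4 * \<tau>^3 * (\<integral>x. w x * (s x)\<^sup>2 * (norm (u x))\<^sup>2 \<partial>lborel)"
      using \<tau> by (intro mult_left_mono) auto
    also have "\<dots> \<le> B"
      unfolding w_def B_def laplacian_def s_def
      by (rule carleman[where K=K]) (fact e \<tau> K | rule Du Dd cu cd cD z; assumption?)+
    finally show ?thesis .
  qed
  \<comment> \<open>Write \<open>h\<^sup>2 * laplacian u\<close> as \<open>W * u\<close> minus
    \<open>schroedinger h W u\<close> and use the bound \<open>pt\<close> on the square of a
    difference.\<close>
  have eq1: "h^4 * B \<le> 2 * F + 2 * M\<^sup>2 * A"
  proof -
    have [measurable]: "laplacian u \<in> borel_measurable lebesgue" "u \<in> borel_measurable lebesgue"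
      "w \<in> borel_measurable lebesgue" "W \<in> borel_measurable lebesgue"
      using cL cu cw W by (auto intro!: measurable_completion borel_measurable_continuous_onI)
    have [measurable]: "schroedinger h W u \<in> borel_measurable lebesgue"
      unfolding schroedinger_def[abs_def] by measurable
    have pt: "(norm (p - q))\<^sup>2 \<le> 2 * (norm p)\<^sup>2 + 2 * (norm q)\<^sup>2" for p q :: complex
    proof -
      have "(norm (p - q))\<^sup>2 \<le> (norm p + norm q)\<^sup>2"
        by (intro power_mono norm_triangle_ineq4) simp
      also have "\<dots> \<le> 2 * (norm p)\<^sup>2 + 2 * (norm q)\<^sup>2"
        using zero_le_power2[of "norm p - norm q"] by (simp add: power2_eq_square algebra_simps)
      finally show ?thesis .
    qed
    have Wu: "AE x in lebesgue. (norm (W x * u x))\<^sup>2 \<le> M\<^sup>2 * (norm (u x))\<^sup>2"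
      using WM
    proof eventually_elim
      fix x assume "norm (W x) \<le> M"
      then show "(norm (W x * u x))\<^sup>2 \<le> M\<^sup>2 * (norm (u x))\<^sup>2"
        by (simp add: norm_mult power_mult_distrib power_mono mult_right_mono)
    qed
    have hL: "(norm (of_real (h\<^sup>2) * laplacian u x))\<^sup>2 = h^4 * (norm (laplacian u x))\<^sup>2" for x
      by (simp add: norm_mult norm_power power_mult_distrib flip: power_mult)
    \<comment> \<open>A non-integrable function has Bochner integral 0 by convention, so comparing
      integrals requires integrability of the right-hand side first.\<close>
    have intF: "integrable lebesgue (\<lambda>x. w x * (norm (schroedinger h W u x))\<^sup>2)"
    proof (rule Bochner_Integration.integrable_bound)
      show "integrable lebesgue (\<lambda>x. 2 * h^4 * (w x * (norm (laplacian u x))\<^sup>2)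
          + 2 * M\<^sup>2 * (w x * (norm (u x))\<^sup>2))"
        using leb(2)[OF contA intA] leb(2)[OF contB intB] by simp
      show "(\<lambda>x. w x * (norm (schroedinger h W u x))\<^sup>2) \<in> borel_measurable lebesgue"
        by measurable
      show "AE x in lebesgue. norm (w x * (norm (schroedinger h W u x))\<^sup>2)
        \<le> norm (2 * h^4 * (w x * (norm (laplacian u x))\<^sup>2) + 2 * M\<^sup>2 * (w x * (norm (u x))\<^sup>2))"
        using Wu
      proof eventually_elim
        fix x assume *: "(norm (W x * u x))\<^sup>2 \<le> M\<^sup>2 * (norm (u x))\<^sup>2"
        have "(norm (schroedinger h W u x))\<^sup>2
            \<le> 2 * (norm (W x * u x))\<^sup>2 + 2 * (norm (of_real (h\<^sup>2) * laplacian u x))\<^sup>2"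
          using pt[of "W x * u x" "of_real (h\<^sup>2) * laplacian u x"] by (simp add: schroedinger_def)
        also have "\<dots> \<le> 2 * h^4 * (norm (laplacian u x))\<^sup>2 + 2 * (M\<^sup>2 * (norm (u x))\<^sup>2)"
          unfolding hL using * by simp
        finally have "w x * (norm (schroedinger h W u x))\<^sup>2
            \<le> w x * (2 * h^4 * (norm (laplacian u x))\<^sup>2 + 2 * (M\<^sup>2 * (norm (u x))\<^sup>2))"
          using w0[of x] by (intro mult_left_mono) auto
        then show "norm (w x * (norm (schroedinger h W u x))\<^sup>2)
          \<le> norm (2 * h^4 * (w x * (norm (laplacian u x))\<^sup>2) + 2 * M\<^sup>2 * (w x * (norm (u x))\<^sup>2))"
          using w0[of x] by (simp add: abs_mult algebra_simps)
      qed
    qed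
    have "h^4 * B = (\<integral>x. h^4 * (w x * (norm (laplacian u x))\<^sup>2) \<partial>lebesgue)"
      using leb(1)[OF contB] by (simp add: B_def)
    also have "\<dots> \<le> (\<integral>x. 2 * (w x * (norm (schroedinger h W u x))\<^sup>2)
        + 2 * M\<^sup>2 * (w x * (norm (u x))\<^sup>2) \<partial>lebesgue)"
    proof (rule integral_mono_AE)
      show "integrable lebesgue (\<lambda>x. h^4 * (w x * (norm (laplacian u x))\<^sup>2))"
        using leb(2)[OF contB intB] by simp
      show "integrable lebesgue (\<lambda>x. 2 * (w x * (norm (schroedinger h W u x))\<^sup>2)
        + 2 * M\<^sup>2 * (w x * (norm (u x))\<^sup>2))"
        using leb(2)[OF contA intA] intF by simp
      show "AE x in lebesgue. h^4 * (w x * (norm (laplacian u x))\<^sup>2)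
        \<le> 2 * (w x * (norm (schroedinger h W u x))\<^sup>2) + 2 * M\<^sup>2 * (w x * (norm (u x))\<^sup>2)"
        using Wu
      proof eventually_elim
        fix x assume *: "(norm (W x * u x))\<^sup>2 \<le> M\<^sup>2 * (norm (u x))\<^sup>2"
        have "h^4 * (norm (laplacian u x))\<^sup>2
            \<le> 2 * (norm (W x * u x))\<^sup>2 + 2 * (norm (schroedinger h W u x))\<^sup>2"
          using pt[of "W x * u x" "schroedinger h W u x"] hL[of x] by (simp add: schroedinger_def)
        also have "\<dots> \<le> 2 * (M\<^sup>2 * (norm (u x))\<^sup>2) + 2 * (norm (schroedinger h W u x))\<^sup>2"
          using * by simp
        finally have "w x * (h^4 * (norm (laplacian u x))\<^sup>2)
            \<le> w x * (2 * (M\<^sup>2 * (norm (u x))\<^sup>2) + 2 * (norm (schroedinger h W u x))\<^sup>2)"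
          using w0[of x] by (intro mult_left_mono) auto
        then show "h^4 * (w x * (norm (laplacian u x))\<^sup>2)
          \<le> 2 * (w x * (norm (schroedinger h W u x))\<^sup>2) + 2 * M\<^sup>2 * (w x * (norm (u x))\<^sup>2)"
          by (simp add: algebra_simps)
      qed
    qed
    also have "\<dots> = 2 * F + 2 * M\<^sup>2 * A"
      using leb(2)[OF contA intA] intF leb(1)[OF contA] by (simp add: F_def A_def)
    finally show ?thesis .
  qed
  have AF: "A \<le> F" and MA: "M\<^sup>2 * A \<le> F"
  proof -
    have "4 * (h^4 * \<tau>^3) * A = h^4 * (4 * \<tau>^3 * A)" by simp
    also have "\<dots> \<le> h^4 * B" using carl h by (intro mult_left_mono) auto
    also note eq1
    finally have 1: "4 * (h^4 * \<tau>^3 * A) \<le> 2 * F + 2 * (M\<^sup>2 * A)" by (simp only: mult.assoc)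
    have 2: "M\<^sup>2 * A \<le> h^4 * \<tau>^3 * A" using M A0 by (rule mult_right_mono)
    have 3: "1 * A \<le> h^4 * \<tau>^3 * A" using one A0 by (rule mult_right_mono)
    \<comment> \<open>With X = \<open>h^4 * \<tau>^3 * A\<close>, facts 1 and 2 give 4X \<le> 2F +
      2X, hence X \<le> F, and X dominates both left-hand sides.\<close>
    show "A \<le> F" "M\<^sup>2 * A \<le> F" using 1 2 3 by linarith+
  qed
  \<comment> \<open>The choice \<alpha> = \<open>1 / h\<^sup>2\<close> balances the terms: after
    multiplication by \<open>h\<^sup>2\<close> they become \<open>A\<close> and
    \<open>h^4 * B\<close>.\<close>
  have "G \<le> (1 / h\<^sup>2 + 4 * \<tau>\<^sup>2 * S\<^sup>2) * A + B / (1 / h\<^sup>2)"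
    unfolding G_def grad A_def B_def w_def laplacian_def s_def
    by (rule weighted_gradient_bound[where K=K])
      (fact e K | rule Du Dd cu cd cD z S[unfolded s_def]; assumption? | use h in simp)+
  then have "h\<^sup>2 * G \<le> h\<^sup>2 * ((1 / h\<^sup>2 + 4 * \<tau>\<^sup>2 * S\<^sup>2) * A + B / (1 / h\<^sup>2))"
    by (rule mult_left_mono) simp
  also have "\<dots> = A + 4 * (h\<^sup>2 * \<tau>\<^sup>2) * S\<^sup>2 * A + h^4 * B"
    using h by (simp add: field_simps flip: power_add)
  \<comment> \<open>\<open>eq1\<close> and \<open>MA\<close> bound \<open>h^4 * B\<close> by
    \<open>4 * F\<close>. The constant 6 below is 1 + 4 from here and 1 from the additional
    \<open>A\<close>.\<close>
  also have "\<dots> \<le> F + 4 * (h\<^sup>2 * \<tau>\<^sup>2) * S\<^sup>2 * F + 4 * F"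
    using AF MA eq1 by (intro add_mono mult_left_mono) auto
  finally have "A + h\<^sup>2 * G \<le> (6 + 4 * (h\<^sup>2 * \<tau>\<^sup>2) * S\<^sup>2) * F"
    using AF by (simp add: algebra_simps)
  moreover have "(\<integral>x. w x * ((norm (u x))\<^sup>2 + (h * grad_norm u x)\<^sup>2) \<partial>lebesgue) = A + h\<^sup>2 * G"
  proof -
    have "w x * ((norm (u x))\<^sup>2 + (h * grad_norm u x)\<^sup>2)
      = w x * (norm (u x))\<^sup>2 + h\<^sup>2 * (w x * (grad_norm u x)\<^sup>2)" for x
      by (simp add: power_mult_distrib algebra_simps)
    then show ?thesis
      using leb[OF contA] leb[OF contG] intA intG by (simp add: A_def G_def)
  qed
  ultimately show ?thesis by (simp add: w_def F_def)
qed

section \<open>Smoothness of the weight\<close>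

lemma partial_eq: "(f has_derivative f') (at x) \<Longrightarrow> partial b f x = f' b"
  by (simp add: partial_def flip: frechet_derivative_at)

lemma Ck_const: "Ck k (\<lambda>x::'a::euclidean_space. c)"
proof (induction k arbitrary: c)
  case (Suc k)
  have "partial b (\<lambda>x::'a. c) = (\<lambda>x. 0)" for b
    by (rule ext, rule partial_eq[of _ "\<lambda>x. 0"]) simp
  then show ?case using Suc by simp
qed simp

lemma Ck_affine: "Ck k (\<lambda>x::'a::euclidean_space. p * (x \<bullet> e) + q :: real)"
proof (cases k)
  case (Suc j)
  have D: "((\<lambda>x::'a. p * (x \<bullet> e) + q) has_derivative (\<lambda>y. p * (y \<bullet> e))) (at x)" for x
    by (auto intro!: derivative_eq_intros)
  then have "partial b (\<lambda>x::'a. p * (x \<bullet> e) + q) = (\<lambda>x. p * (b \<bullet> e))" for b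
    by (intro ext partial_eq[OF D])
  then show ?thesis using Suc D by (auto simp: Ck_const differentiable_def)
qed (auto intro!: continuous_intros)

text \<open>One unfolding of the recursion suffices at each order, because the partial derivatives
  are affine and fall under \<open>Ck_affine\<close>.\<close>

lemma smooth_quadratic: "smooth (\<lambda>x::'a::euclidean_space. a * (x \<bullet> e + c)\<^sup>2)"
  unfolding smooth_def
proof
  fix k
  show "Ck k (\<lambda>x::'a. a * (x \<bullet> e + c)\<^sup>2)"
  proof (cases k)
    case (Suc j)
    have D: "((\<lambda>x::'a. a * (x \<bullet> e + c)\<^sup>2) has_derivative (\<lambda>y. 2 * a * (x \<bullet> e + c) * (y \<bullet> e))) (at x)" for x
      by (auto intro!: derivative_eq_intros)
    have "partial b (\<lambda>x::'a. a * (x \<bullet> e + c)\<^sup>2)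
        = (\<lambda>x. 2 * a * (b \<bullet> e) * (x \<bullet> e) + 2 * a * c * (b \<bullet> e))" for b
      by (rule ext, subst partial_eq[OF D]) (simp add: algebra_simps)
    then show ?thesis using Suc D by (auto simp: Ck_affine differentiable_def)
  qed (auto intro!: continuous_intros)
qed

section \<open>The potential bound and the choice of constants\<close>

lemma Linf_norm_AE:
  assumes "Linf_norm f \<le> ereal C"
  shows "AE x in lebesgue. norm (f x) \<le> C"
  using esssup_AE[where M=lebesgue and f="\<lambda>x. ereal (norm (f x))"]
proof eventually_elim
  fix x assume "ereal (norm (f x)) \<le> esssup lebesgue (\<lambda>x. ereal (norm (f x)))"
  also have "\<dots> \<le> ereal C" using assms by (simp add: Linf_norm_def)
  finally show "norm (f x) \<le> C" by simp
qed

theorem lemma4: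
  fixes R\<^sub>0 C\<^sub>V R :: real
    and V :: "real \<Rightarrow> 'a::euclidean_space \<Rightarrow> complex"
    and I :: "real set"
  assumes "R\<^sub>0 > 0" and "C\<^sub>V > 0"
    and "\<And>h. h \<in> {0<..1} \<Longrightarrow> V h \<in> borel_measurable lebesgue"
    and "\<And>h. h \<in> {0<..1} \<Longrightarrow> Linf_norm (V h) \<le> ereal C\<^sub>V"
    and "\<And>h. h \<in> {0<..1} \<Longrightarrow> ess_support (V h) \<subseteq> ball 0 R\<^sub>0"
    and "is_interval I" and "compact I"
    and "R > R\<^sub>0"
  shows "\<exists>(\<phi> :: 'a \<Rightarrow> real) C h\<^sub>0. smooth \<phi> \<and> C > 0 \<and> h\<^sub>0 \<in> {0<..1} \<and>
    (\<forall>u \<in> Cc_infinity (ball 0 R). \<forall>lam \<in> I. \<forall>h. 0 < h \<and> h \<le> h\<^sub>0 \<longrightarrow>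
      (\<integral>x. exp (2 * \<phi> x / h powr (4/3)) * ((norm (u x))\<^sup>2 + (h * grad_norm u x)\<^sup>2) \<partial>lebesgue)
      \<le> C / h powr (2/3) *
        (\<integral>x. exp (2 * \<phi> x / h powr (4/3)) *
             (norm (schroedinger h (V h) u x - of_real (lam\<^sup>2) * u x))\<^sup>2 \<partial>lebesgue))"
proof -
  obtain e :: 'a where e: "e \<in> Basis" using nonempty_Basis by blast
  obtain L where L: "\<And>lam. lam \<in> I \<Longrightarrow> \<bar>lam\<bar> \<le> L"
    using compact_imp_bounded[OF \<open>compact I\<close>] by (auto simp: bounded_iff)
  \<comment> \<open>Bounds the modulus of \<open>V h x - lam\<^sup>2\<close> for almost every
    \<open>x\<close>, uniformly in \<open>h\<close> and \<open>lam\<close>.\<close>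
  define M where "M = C\<^sub>V + L\<^sup>2"
  have M0: "0 \<le> M" using \<open>C\<^sub>V > 0\<close> by (simp add: M_def)
  \<comment> \<open>Then \<open>K^3 \<ge> K\<close> dominates both 1 and \<open>M\<^sup>2\<close>,
    the two size conditions of \<open>perturbed_carleman\<close>.\<close>
  define K where "K = 1 + M\<^sup>2"
  have K1: "1 \<le> K" by (simp add: K_def)
  have K3: "K \<le> K^3" using K1 by (metis one_le_numeral power_increasing power_one_right)
  \<comment> \<open>On the support of \<open>u\<close> one has
    \<open>\<bar>x \<bullet> e\<bar> < R\<close>, so \<open>x \<bullet> e + (R + 1)\<close> lies
    between 1 and \<open>S\<close>.\<close>
  define S where "S = 2 * R + 1"
  define C where "C = 6 + 4 * K\<^sup>2 * S\<^sup>2"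
  \<comment> \<open>The factor 1/2 makes the exponent \<open>2 * \<phi> x / h powr (4/3)\<close>
    equal to \<tau> times the squared affine function.\<close>
  define \<phi> where "\<phi> x = K / 2 * (x \<bullet> e + (R + 1))\<^sup>2" for x
  have "smooth \<phi>" unfolding \<phi>_def[abs_def] by (rule smooth_quadratic)
  moreover have "C > 0" by (simp add: C_def add_pos_nonneg)
  moreover have "(\<integral>x. exp (2 * \<phi> x / h powr (4/3)) * ((norm (u x))\<^sup>2 + (h * grad_norm u x)\<^sup>2) \<partial>lebesgue)
      \<le> C / h powr (2/3) *
        (\<integral>x. exp (2 * \<phi> x / h powr (4/3)) *
             (norm (schroedinger h (V h) u x - of_real (lam\<^sup>2) * u x))\<^sup>2 \<partial>lebesgue)"
    if u: "u \<in> Cc_infinity (ball 0 R)" and lam: "lam \<in> I" and h: "0 < h" "h \<le> 1" for u lam h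
  proof -
    define \<tau> where "\<tau> = K / h powr (4/3)"
    have \<tau>0: "0 \<le> \<tau>" using K1 by (simp add: \<tau>_def)
    have \<phi>\<tau>: "2 * \<phi> x / h powr (4/3) = \<tau> * (x \<bullet> e + (R + 1))\<^sup>2" for x
      by (simp add: \<phi>_def \<tau>_def)
    \<comment> \<open>The exponent 4/3 is the one that makes \<open>h^4 * \<tau>^3\<close>
      independent of \<open>h\<close>.\<close>
    have "(h powr (4/3))^3 = h^4"
      using h powr_realpow[of h 4] by (simp add: powr_power)
    then have t3: "h^4 * \<tau>^3 = K^3" using h by (simp add: \<tau>_def power_divide)
    have "(h powr (4/3))\<^sup>2 = h\<^sup>2 * h powr (2/3)"
      using h powr_realpow[of h 2] powr_add[of h 2 "2/3"] by (simp add: powr_power)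
    then have t2: "h\<^sup>2 * \<tau>\<^sup>2 = K\<^sup>2 / h powr (2/3)" using h by (simp add: \<tau>_def power_divide)
    \<comment> \<open>The spectral term is moved into the potential.\<close>
    define W where "W x = V h x - of_real (lam\<^sup>2)" for x
    have hin: "h \<in> {0<..1}" using h by simp
    have W: "W \<in> borel_measurable lebesgue"
      unfolding W_def[abs_def] using assms(3)[OF hin] by measurable
    have WM: "AE x in lebesgue. norm (W x) \<le> M"
      using Linf_norm_AE[OF assms(4)[OF hin]]
    proof eventually_elim
      fix x assume *: "norm (V h x) \<le> C\<^sub>V"
      have "norm (W x) \<le> norm (V h x) + norm (of_real (lam\<^sup>2) :: complex)"
        unfolding W_def by (rule norm_triangle_ineq4)
      also have "norm (of_real (lam\<^sup>2) :: complex) = lam\<^sup>2" by (simp add: norm_power)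
      also have "lam\<^sup>2 \<le> L\<^sup>2" using L[OF lam] by (metis abs_ge_zero power2_abs power_mono)
      finally show "norm (W x) \<le> M" using * by (simp add: M_def)
    qed
    have sch: "schroedinger h W u x = schroedinger h (V h) u x - of_real (lam\<^sup>2) * u x" for x
      by (simp add: schroedinger_def W_def algebra_simps)
    define T where "T = closure {x. u x \<noteq> 0}"
    have sm: "smooth u" and T: "compact T" "T \<subseteq> ball 0 R"
      using u by (auto simp: Cc_infinity_def T_def)
    have z: "u x = 0" if "x \<notin> T" for x
      using that closure_subset[of "{x. u x \<noteq> 0}"] by (auto simp: T_def)
    have xe: "\<bar>x \<bullet> e\<bar> < R" if "x \<in> T" for x
    proof -
      have "norm x < R" using that T by auto
      then show ?thesis using Basis_le_norm[OF e, of x] by linarith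
    qed
    define P where "P = h powr (2/3)"
    have P: "0 < P" "P \<le> 1" using h by (auto simp: P_def powr_le1)
    let ?F = "\<integral>x. exp (\<tau> * (x \<bullet> e + (R + 1))\<^sup>2) * (norm (schroedinger h W u x))\<^sup>2 \<partial>lebesgue"
    have "(\<integral>x. exp (\<tau> * (x \<bullet> e + (R + 1))\<^sup>2) * ((norm (u x))\<^sup>2 + (h * grad_norm u x)\<^sup>2) \<partial>lebesgue)
      \<le> (6 + 4 * (h\<^sup>2 * \<tau>\<^sup>2) * S\<^sup>2) * ?F"
    proof (rule perturbed_carleman[OF e \<tau>0 h(1) _ _ W WM sm T(1) z])
      show "M\<^sup>2 \<le> h^4 * \<tau>^3" "1 \<le> h^4 * \<tau>^3" using K1 K3 by (simp_all add: t3 K_def)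
      fix x assume "x \<in> T"
      from xe[OF this] show "1 \<le> x \<bullet> e + (R + 1)" "\<bar>x \<bullet> e + (R + 1)\<bar> \<le> S"
        by (auto simp: S_def)
    qed
    also have "\<dots> \<le> C / P * ?F"
    proof (rule mult_right_mono)
      \<comment> \<open>Since \<open>P \<le> 1\<close>, the constant 6 may be divided by
        \<open>P\<close>; the other summand already carries \<open>1 / P\<close> by
        \<open>t2\<close>.\<close>
      have "6 \<le> 6 / P" using P by (simp add: field_simps)
      then show "6 + 4 * (h\<^sup>2 * \<tau>\<^sup>2) * S\<^sup>2 \<le> C / P"
        unfolding t2 C_def P_def[symmetric] by (simp add: add_divide_distrib)
    qed (simp add: integral_nonneg_AE)
    finally show ?thesis unfolding \<phi>\<tau> sch P_def .
  qed
  \<comment> \<open>The estimate was shown for every \<open>h\<close> in (0,1], so 1 serves as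
    \<open>h\<^sub>0\<close>.\<close>
  ultimately show ?thesis
    by (intro exI[of _ \<phi>] exI[of _ C] exI[of _ 1]) auto
qed

end
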